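(* Let $x_1=(0,1)$, $b_1=2$ and $l_1=0$. For $i\ge2$, let $x_i=C_{i,i^2}$, $b_i=i$ and $l_i=i^{3i}$. Let $L_i=\sum_{j=1}^i l_j|x_j|$ (with $L_0=0$), let $q_n=b_i$ for $L_{i-1}<n\le L_i$, $Q=\{q_n\}_{n=1}^\infty$, let $(E_1,E_2,\ldots)=l_1x_1\,l_2x_2\,l_3x_3\ldots$, and let $x=\sum_{n=1}^\infty\frac{E_n}{q_1q_2\cdots q_n}$. Then $x$ is $Q$-normal.
   Context: A block of length $k$ in base $b$ is an ordered $k$-tuple of integers in $\{0,1,\ldots,b-1\}$; a block is a block of some length in some base. $|B|$ is the length of $B$. For blocks $B_1,B_2,\ldots$ and non-negative integers $l_1,l_2,\ldots$, $l_1B_1\,l_2B_2\ldots$ denotes the concatenation of $l_1$ copies of $B_1$, then $l_2$ copies of $B_2$, and so on. $C_{b,w}$ is the block formed by concatenating all $b^w$ blocks of length $w$ in base $b$ in lexicographic order (so $|C_{b,w}|=wb^w$); e.g. $C_{3,2}=(0,0,0,1,0,2,1,0,1,1,1,2,2,0,2,1,2,2)$. A basic sequence is a sequence $Q=\{q_n\}_{n\ge1}$ of integers $q_n\ge2$. The $Q$-Cantor series expansion of $x\in[0,1)$ is the unique expansion $x=\sum_{n\ge1}\frac{E_n}{q_1\cdots q_n}$ with $E_n\in\{0,\ldots,q_n-1\}$ and $E_n\ne q_n-1$ infinitely often. $N_n^Q(B,x)$ is the number of occurrences of the block $B$ (as consecutive digits) in the $Q$-Cantor series expansion of $x$ with starting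 position at most $n$. $Q_n^{(k)}=\sum_{j=1}^n\frac{1}{q_jq_{j+1}\cdots q_{j+k-1}}$. $x$ is $Q$-normal of order $k$ if $\lim_{n\to\infty}N_n^Q(B,x)/Q_n^{(k)}=1$ for all blocks $B$ of length $k$ (in any base), and $Q$-normal if it is $Q$-normal of order $k$ for all positive integers $k$. *)

theory Defs
  imports Complex_Main
begin

text \<open>Digits are natural numbers, so every \<^typ>\<open>nat list\<close> is a block in every sufficiently large
  base.  Sequences are indexed from 1; the values at 0 play no role.\<close>

type_synonym block = "nat list"

definition copies :: "nat \<Rightarrow> block \<Rightarrow> block" where
  "copies l B = concat (replicate l B)"

text \<open>\<^const>\<open>product_lists\<close> enumerates with the first entry varying slowest, that is, in
  lexicographic order; see \<open>blocks_lex\<close> below.\<close>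

definition blocks :: "nat \<Rightarrow> nat \<Rightarrow> block list" where
  "blocks b w = product_lists (replicate w [0..<b])"

definition C :: "nat \<Rightarrow> nat \<Rightarrow> block" where
  "C b w = concat (blocks b w)"

lemma set_blocks: "set (blocks b w) = {B. length B = w \<and> set B \<subseteq> {..<b}}"
  unfolding blocks_def
proof (induction w)
  case (Suc w)
  have "set (product_lists (replicate (Suc w) [0..<b])) =
      (\<Union>a\<in>{..<b}. Cons a ` {B. length B = w \<and> set B \<subseteq> {..<b}})"
    using Suc by auto
  also have "\<dots> = {B. length B = Suc w \<and> set B \<subseteq> {..<b}}"
    by (auto simp: length_Suc_conv image_iff)
  finally show ?case .
qed auto

lemma sorted_wrt_concat_map_Cons:
  assumes "sorted_wrt (<) (xs :: nat list)"
    and "sorted_wrt (\<lambda>u v. (u, v) \<in> lexord {(m, n). m < n}) L"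
  shows "sorted_wrt (\<lambda>u v. (u, v) \<in> lexord {(m, n). m < n})
    (concat (map (\<lambda>x. map (Cons x) L) xs))"
  using assms(1)
proof (induction xs)
  case (Cons x xs)
  then show ?case
    using assms(2) by (auto simp: sorted_wrt_append sorted_wrt_map)
qed simp

text \<open>Strictly sorted, so each block of length \<open>w\<close> in base \<open>b\<close> is listed exactly once.\<close>

lemma blocks_lex: "sorted_wrt (\<lambda>u v. (u, v) \<in> lexord {(m, n). m < n}) (blocks b w)"
  unfolding blocks_def
  by (induction w) (simp_all add: sorted_wrt_concat_map_Cons)

lemma "C 3 2 = [0,0,0,1,0,2,1,0,1,1,1,2,2,0,2,1,2,2]"
  by (simp add: C_def blocks_def numeral_2_eq_2 numeral_3_eq_3)

definition basic_sequence :: "(nat \<Rightarrow> nat) \<Rightarrow> bool" where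
  "basic_sequence q \<longleftrightarrow> (\<forall>n\<ge>1. q n \<ge> 2)"

definition cantor_expansion :: "(nat \<Rightarrow> nat) \<Rightarrow> real \<Rightarrow> (nat \<Rightarrow> nat) \<Rightarrow> bool" where
  "cantor_expansion q x E \<longleftrightarrow>
     (\<lambda>n. real (E (Suc n)) / (\<Prod>j=1..Suc n. real (q j))) sums x \<and>
     (\<forall>n\<ge>1. E n \<in> {0..q n - 1}) \<and>
     infinite {n. n \<ge> 1 \<and> E n \<noteq> q n - 1}"

text \<open>The condition \<open>E 0 = 0\<close> only fixes the unused value at 0, which would otherwise spoil
  uniqueness.\<close>

definition cantor_digits :: "(nat \<Rightarrow> nat) \<Rightarrow> real \<Rightarrow> nat \<Rightarrow> nat" where
  "cantor_digits q x = (THE E. E 0 = 0 \<and> cantor_expansion q x E)"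

definition N :: "(nat \<Rightarrow> nat) \<Rightarrow> nat \<Rightarrow> block \<Rightarrow> real \<Rightarrow> nat" where
  "N q n B x = card {i \<in> {1..n}. map (cantor_digits q x) [i..<i + length B] = B}"

definition Q_sum :: "(nat \<Rightarrow> nat) \<Rightarrow> nat \<Rightarrow> nat \<Rightarrow> real" where
  "Q_sum q k n = (\<Sum>j=1..n. 1 / (\<Prod>m=j..<j + k. real (q m)))"

text \<open>Normality is a notion for a basic sequence \<open>q\<close> and \<open>x\<close> in the unit interval, outside of which
  \<^const>\<open>cantor_digits\<close> is meaningless; both requirements are made part of the definition.\<close>

definition Q_normal_of_order :: "(nat \<Rightarrow> nat) \<Rightarrow> nat \<Rightarrow> real \<Rightarrow> bool" where
  "Q_normal_of_order q k x \<longleftrightarrow>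
     basic_sequence q \<and> 0 \<le> x \<and> x < 1 \<and>
     (\<forall>B. length B = k \<longrightarrow> (\<lambda>n. real (N q n B x) / Q_sum q k n) \<longlonglongrightarrow> 1)"

definition Q_normal :: "(nat \<Rightarrow> nat) \<Rightarrow> real \<Rightarrow> bool" where
  "Q_normal q x \<longleftrightarrow> (\<forall>k\<ge>1. Q_normal_of_order q k x)"

end

theory Submission
  imports Defs "HOL-Real_Asymp.Real_Asymp"
begin

text \<open>Read cyclically, \<open>C b w\<close> contains every block of length \<open>k \<le> w\<close> in base \<open>b\<close> exactly
  \<open>w * b ^ (w - k)\<close> times, that is, with frequency exactly \<open>1 / b ^ k\<close>.  Hence a full stage of copies
  of \<open>C i (i\<^sup>2)\<close> changes the difference between \<open>N\<close> and \<open>Q_sum\<close> by at most \<open>2 * k\<close>, coming from the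
  boundary to the next stage, and inside stage \<open>i + 1\<close> an incomplete copy contributes at most
  \<open>\<bar>x\<^sub>i\<^sub>+\<^sub>1\<bar> / (i + 1) ^ k\<close>.  This is negligible against the contribution \<open>l\<^sub>i \<bar>x\<^sub>i\<bar> / i ^ k\<close> of stage \<open>i\<close>
  to \<open>Q_sum\<close>, since \<open>\<bar>x\<^sub>i\<^sub>+\<^sub>1\<bar> / (l\<^sub>i \<bar>x\<^sub>i\<bar>)\<close> is of the order \<open>i * exp i / i ^ i\<close>.\<close>

subsection \<open>Cyclic occurrences of a block in \<open>C b w\<close>\<close>

definition digit :: "nat \<Rightarrow> nat \<Rightarrow> nat \<Rightarrow> nat" where
  "digit b v e = v div b ^ e mod b"

lemma digit_less: "b > 0 \<Longrightarrow> digit b v e < b"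
  by (simp add: digit_def)

lemma digit_add_mult:
  assumes "e < w"
  shows "digit b (x * b ^ w + v) e = digit b v e"
proof -
  have "b ^ w = b ^ (w - Suc e) * b * b ^ e"
    using assms by (metis Suc_diff_Suc diff_add_inverse2 le_add_diff_inverse2 less_imp_le_nat power_Suc2 power_add)
  then have eq: "x * b ^ w + v = v + (x * b ^ (w - Suc e) * b) * b ^ e"
    by (simp add: algebra_simps)
  show ?thesis
  proof (cases "b = 0")
    case False
    then show ?thesis unfolding digit_def eq by (simp add: div_mult_self1)
  qed (use assms in \<open>simp add: power_0_left\<close>)
qed

lemma digit_top: "v < b ^ w \<Longrightarrow> x < b \<Longrightarrow> digit b (x * b ^ w + v) w = x"
  by (simp add: digit_def)

lemma digit_mod: "e < w \<Longrightarrow> digit b (v mod b ^ w) e = digit b v e"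
  by (metis digit_add_mult div_mult_mod_eq)

text \<open>Converts agreement of the last \<open>h\<close> digits into a congruence, a form in
  which passing from a number to its successor is easy.\<close>

lemma digits_eq_iff_mod_eq: "(\<forall>e<h. digit b u e = digit b v e) \<longleftrightarrow> u mod b ^ h = v mod b ^ h"
proof (induction h)
  case (Suc h)
  have split: "z mod b ^ Suc h = b ^ h * digit b z h + z mod b ^ h" for z
    unfolding digit_def by (metis mod_mult2_eq power_Suc2)
  show ?case
  proof
    assume "\<forall>e<Suc h. digit b u e = digit b v e"
    then show "u mod b ^ Suc h = v mod b ^ Suc h"
      using Suc unfolding split by (metis less_Suc_eq)
  next
    assume "u mod b ^ Suc h = v mod b ^ Suc h"
    then show "\<forall>e<Suc h. digit b u e = digit b v e"
      by (metis digit_mod)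
  qed
qed simp

text \<open>Digits in different positions are independent, so each of the \<open>w - card D\<close>
  free positions contributes a factor \<open>b\<close>. The induction splits off the top
  digit.\<close>

lemma card_digits_prescribed:
  assumes "b > 0" "D \<subseteq> {..<w}" "\<And>e. e \<in> D \<Longrightarrow> f e < b"
  shows "card {v. v < b ^ w \<and> (\<forall>e\<in>D. digit b v e = f e)} = b ^ (w - card D)"
  using assms(2,3)
proof (induction w arbitrary: D)
  case 0
  then have "D = {}" by auto
  then show ?case by simp
next
  case (Suc w)
  \<comment> \<open>\<open>A\<close> holds the admissible top digits and \<open>S\<close> the
    admissible remainders below \<open>b ^ w\<close>; the set to be counted is in bijection with
    \<open>A \<times> S\<close>.\<close>
  define D' where "D' = D - {w}"
  define A where "A = (if w \<in> D then {f w} else {..<b})"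
  define S where "S = {v. v < b ^ w \<and> (\<forall>e\<in>D'. digit b v e = f e)}"
  have D': "D' \<subseteq> {..<w}"
    using Suc.prems(1) by (auto simp: D'_def less_Suc_eq)
  have cS: "card S = b ^ (w - card D')"
    unfolding S_def using D' Suc.prems(2) by (intro Suc.IH) (auto simp: D'_def)
  have A_less: "a < b" if "a \<in> A" for a
    using that Suc.prems(2) by (auto simp: A_def split: if_splits)
  have "{v. v < b ^ Suc w \<and> (\<forall>e\<in>D. digit b v e = f e)} = (\<lambda>(a, v). a * b ^ w + v) ` (A \<times> S)"
  proof (intro subset_antisym subsetI)
    fix v assume "v \<in> {v. v < b ^ Suc w \<and> (\<forall>e\<in>D. digit b v e = f e)}"
    then have v: "v < b ^ Suc w" "\<And>e. e \<in> D \<Longrightarrow> digit b v e = f e" by auto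
    have less: "v div b ^ w < b"
      using v(1) assms(1) by (simp add: div_less_iff_less_mult)
    then have "digit b v w = v div b ^ w"
      by (simp add: digit_def)
    then have "v div b ^ w \<in> A"
      using v(2) less by (auto simp: A_def)
    moreover have "v mod b ^ w \<in> S"
      unfolding S_def using v(2) D' assms(1) by (auto simp: D'_def digit_mod subset_iff)
    ultimately have "(v div b ^ w, v mod b ^ w) \<in> A \<times> S" by simp
    moreover have "v = (\<lambda>(a, v). a * b ^ w + v) (v div b ^ w, v mod b ^ w)"
      by (simp only: case_prod_conv div_mult_mod_eq)
    ultimately show "v \<in> (\<lambda>(a, v). a * b ^ w + v) ` (A \<times> S)" by (rule rev_image_eqI)
  next
    fix v assume "v \<in> (\<lambda>(a, v). a * b ^ w + v) ` (A \<times> S)"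
    then obtain a u where v: "v = a * b ^ w + u" and a: "a \<in> A" and u: "u \<in> S" by auto
    have u': "u < b ^ w" using u by (simp add: S_def)
    have "v < (a + 1) * b ^ w" using u' v by simp
    also have "\<dots> \<le> b ^ Suc w"
      using A_less[OF a] by (simp only: power_Suc) (intro mult_right_mono, auto)
    finally have "v < b ^ Suc w" .
    moreover have "digit b v e = f e" if "e \<in> D" for e
    proof (cases "e = w")
      case True
      then show ?thesis
        using digit_top[OF u' A_less[OF a]] a that by (simp add: v A_def)
    next
      case False
      then have "e \<in> D'" using that by (simp add: D'_def)
      then show ?thesis
        using D' u by (auto simp: v digit_add_mult S_def)
    qed
    ultimately show "v \<in> {v. v < b ^ Suc w \<and> (\<forall>e\<in>D. digit b v e = f e)}" by simp
  qed
  moreover have "inj_on (\<lambda>(a, v). a * b ^ w + v) (A \<times> S)"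
  proof (rule inj_onI, clarify)
    fix a u a' u' assume eq: "a * b ^ w + u = a' * b ^ w + u'" and S: "u \<in> S" "u' \<in> S"
    have less: "u < b ^ w" "u' < b ^ w" using S by (auto simp: S_def)
    have "(a * b ^ w + u) div b ^ w = (a' * b ^ w + u') div b ^ w" using eq by simp
    then have "a = a'" using less assms(1) by simp
    then show "a = a' \<and> u = u'" using eq by simp
  qed
  ultimately have card: "card {v. v < b ^ Suc w \<and> (\<forall>e\<in>D. digit b v e = f e)} = card A * b ^ (w - card D')"
    by (simp add: card_image card_cartesian_product cS)
  have fin: "finite D" using Suc.prems(1) finite_subset by blast
  have le: "card D' \<le> w" using card_mono[OF _ D'] by simp
  show ?case
  proof (cases "w \<in> D")
    case True
    then have "card D = Suc (card D')"
      using card_Suc_Diff1[OF fin True] by (simp add: D'_def)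
    then show ?thesis unfolding card by (simp add: A_def True)
  next
    case False
    then have "D' = D" by (auto simp: D'_def)
    then show ?thesis unfolding card using le by (simp add: A_def False Suc_diff_le)
  qed
qed

section \<open>The digit sequence of \<open>C b w\<close> and its periodic extension\<close>

definition C_digit :: "nat \<Rightarrow> nat \<Rightarrow> nat \<Rightarrow> nat" where
  "C_digit b w j = digit b (j div w) (w - 1 - j mod w)"

lemma upt_mult: "[0..<m * n] = concat (map (\<lambda>x. map (\<lambda>v. x * n + v) [0..<n]) [0..<m])"
proof (induction m)
  case (Suc m)
  have "[0..<Suc m * n] = [0..<m * n] @ [m * n..<m * n + n]"
    by (metis add.commute le0 mult_Suc upt_add_eq_append)
  moreover have "[m * n..<m * n + n] = map (\<lambda>v. m * n + v) [0..<n]"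
    using map_add_upt[of "m * n" n] by (simp add: add.commute)
  ultimately show ?case using Suc by simp
qed simp

text \<open>In lexicographic order, word number \<open>v\<close> is \<open>v\<close> itself written
  with \<open>w\<close> digits. The first letter is the most significant digit, whereas
  \<open>digit\<close> counts from the least significant one; hence the reversed index.\<close>

lemma blocks_eq: "blocks b w = map (\<lambda>v. map (\<lambda>s. digit b v (w - 1 - s)) [0..<w]) [0..<b ^ w]"
proof (induction w)
  case 0
  then show ?case by (simp add: blocks_def)
next
  case (Suc w)
  have "map (\<lambda>s. digit b (x * b ^ w + v) (Suc w - 1 - s)) [0..<Suc w]
      = x # map (\<lambda>s. digit b v (w - 1 - s)) [0..<w]" if "x < b" "v < b ^ w" for x v
  proof -
    have "map (\<lambda>s. digit b (x * b ^ w + v) (Suc w - 1 - s)) [0..<Suc w]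
      = digit b (x * b ^ w + v) w # map (\<lambda>s. digit b (x * b ^ w + v) (w - Suc s)) [0..<w]"
      by (simp add: upt_conv_Cons map_Suc_upt[symmetric] comp_def del: upt_Suc)
    moreover have "digit b (x * b ^ w + v) (w - Suc s) = digit b v (w - 1 - s)" if "s < w" for s
      using that by (simp add: digit_add_mult)
    ultimately show ?thesis using that by (simp add: digit_top)
  qed
  moreover have "blocks b (Suc w) = concat (map (\<lambda>x. map (Cons x) (blocks b w)) [0..<b])"
    by (simp add: blocks_def)
  ultimately show ?case
    unfolding Suc power_Suc upt_mult by (auto simp: map_concat comp_def intro!: arg_cong[of _ _ concat])
qed

lemma C_eq: "C b w = map (C_digit b w) [0..<b ^ w * w]"
  unfolding C_def blocks_eq upt_mult
  by (auto simp: map_concat comp_def C_digit_def intro!: arg_cong[of _ _ concat])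

lemma length_C: "length (C b w) = b ^ w * w"
  by (simp add: C_eq)

text \<open>A shift by whole periods adds a multiple of \<open>b ^ w\<close> to the word number,
  which the digits below position \<open>w\<close> do not see. So \<open>C_digit\<close> needs no
  reduction of its argument to describe repeated copies.\<close>

lemma C_digit_add_period:
  assumes "w > 0"
  shows "C_digit b w (m * (b ^ w * w) + j) = C_digit b w j"
proof -
  have eq: "m * (b ^ w * w) + j = j + w * (m * b ^ w)" by simp
  have "(m * (b ^ w * w) + j) div w = m * b ^ w + j div w"
    unfolding eq using assms by simp
  moreover have "(m * (b ^ w * w) + j) mod w = j mod w"
    unfolding eq by simp
  ultimately show ?thesis
    using assms by (simp add: C_digit_def digit_add_mult)
qed

lemma copies_C_eq:
  assumes "w > 0"
  shows "copies l (C b w) = map (C_digit b w) [0..<l * (b ^ w * w)]"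
proof -
  have "map (C_digit b w) (map (\<lambda>j. m * (b ^ w * w) + j) [0..<b ^ w * w]) = C b w" for m
    by (simp add: C_eq C_digit_add_period[OF assms])
  then show ?thesis
    unfolding copies_def upt_mult
    by (simp add: map_concat comp_def map_replicate_const C_digit_add_period[OF assms] flip: C_eq)
qed

section \<open>Counting occurrences in one period, offset by offset\<close>

lemma card_less_mult:
  "card {j. j < n * m \<and> P j} = (\<Sum>s<m. card {v::nat. v < n \<and> P (v * m + s)})"
proof -
  have "{j. j < n * m \<and> P j} = (\<lambda>(s, v). v * m + s) ` (SIGMA s:{..<m}. {v. v < n \<and> P (v * m + s)})"
  proof (intro subset_antisym subsetI)
    fix j assume j: "j \<in> {j. j < n * m \<and> P j}"
    then have "m > 0" by (cases m) auto
    then have "(j mod m, j div m) \<in> (SIGMA s:{..<m}. {v. v < n \<and> P (v * m + s)})"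
      using j by (auto simp: div_less_iff_less_mult)
    moreover have "j = (\<lambda>(s, v). v * m + s) (j mod m, j div m)" by simp
    ultimately show "j \<in> (\<lambda>(s, v). v * m + s) ` (SIGMA s:{..<m}. {v. v < n \<and> P (v * m + s)})"
      by (rule rev_image_eqI)
  next
    fix j assume "j \<in> (\<lambda>(s, v). v * m + s) ` (SIGMA s:{..<m}. {v. v < n \<and> P (v * m + s)})"
    then obtain s v where sv: "j = v * m + s" "s < m" "v < n" "P j" by auto
    have "j < (v + 1) * m" using sv by simp
    also have "\<dots> \<le> n * m" using sv by (intro mult_right_mono) auto
    finally show "j \<in> {j. j < n * m \<and> P j}" using sv by simp
  qed
  moreover have "inj_on (\<lambda>(s, v). v * m + s) (SIGMA s:{..<m}. {v. v < n \<and> P (v * m + s)})"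
  proof (rule inj_onI, clarsimp)
    fix s v s' v' assume eq: "v * m + s = v' * m + s'" and less: "s < m" "s' < m"
    have "(v * m + s) div m = (v' * m + s') div m" using eq by simp
    then have "v = v'" using less by simp
    then show "s = s' \<and> v = v'" using eq by simp
  qed
  ultimately show ?thesis
    by (simp add: card_image)
qed

text \<open>The cyclic successor permutes the residues below \<open>M\<close>. This allows counting
  by the successor of a word instead of the word.\<close>

lemma card_Suc_mod: "card {v. v < M \<and> P (Suc v mod M)} = card {u. u < M \<and> P u}"
proof (cases "M = 0")
  case False
  have inj: "inj_on (\<lambda>v. Suc v mod M) {..<M}"
    by (auto simp: inj_on_def mod_Suc split: if_splits)
  have "(\<lambda>v. Suc v mod M) ` {..<M} = {..<M}"
    using False by (intro endo_inj_surj inj) auto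
  then have "{u. u < M \<and> P u} = {u \<in> (\<lambda>v. Suc v mod M) ` {..<M}. P u}"
    by simp
  also have "\<dots> = (\<lambda>v. Suc v mod M) ` {v. v < M \<and> P (Suc v mod M)}"
    by auto
  finally have "{u. u < M \<and> P u} = (\<lambda>v. Suc v mod M) ` {v. v < M \<and> P (Suc v mod M)}" .
  moreover have "inj_on (\<lambda>v. Suc v mod M) {v. v < M \<and> P (Suc v mod M)}"
    by (rule inj_on_subset[OF inj]) auto
  ultimately show ?thesis by (simp add: card_image)
qed simp

text \<open>Since \<open>C_digit\<close> is periodic, a window running past the end of
  \<open>C b w\<close> continues at its beginning: these are the cyclic occurrences.\<close>

definition C_match :: "nat \<Rightarrow> nat \<Rightarrow> block \<Rightarrow> nat \<Rightarrow> bool" where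
  "C_match b w B j \<longleftrightarrow> (\<forall>t<length B. C_digit b w (j + t) = B ! t)"

lemma C_digit_word: "s < w \<Longrightarrow> C_digit b w (v * w + s) = digit b v (w - 1 - s)"
  by (simp add: C_digit_def)

text \<open>The window lies inside the single word \<open>v\<close>, so a match prescribes
  \<open>length B\<close> digits of \<open>v\<close> and leaves the others free.\<close>

lemma card_C_match_aligned:
  assumes "b > 0" "set B \<subseteq> {..<b}" "s + length B \<le> w"
  shows "card {v. v < b ^ w \<and> C_match b w B (v * w + s)} = b ^ (w - length B)"
proof -
  \<comment> \<open>\<open>D\<close> is the window as a set of digit positions: letter
    \<open>t\<close> of the block sits at position \<open>w - 1 - s - t\<close>.\<close>
  define k D where "k = length B" and "D = {w - s - k..<w - s}"
  have "C_match b w B (v * w + s) \<longleftrightarrow> (\<forall>e\<in>D. digit b v e = B ! (w - 1 - s - e))" for v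
  proof -
    have "C_match b w B (v * w + s) \<longleftrightarrow> (\<forall>t<k. digit b v (w - 1 - s - t) = B ! t)"
      using assms(3) by (auto simp: C_match_def k_def add.assoc C_digit_word)
    also have "\<dots> \<longleftrightarrow> (\<forall>e\<in>D. digit b v e = B ! (w - 1 - s - e))" (is "?l \<longleftrightarrow> ?r")
    proof
      assume l: ?l
      show ?r
      proof
        fix e assume "e \<in> D"
        then have "w - 1 - s - e < k" "w - 1 - s - (w - 1 - s - e) = e"
          using assms(3) by (auto simp: D_def k_def)
        then show "digit b v e = B ! (w - 1 - s - e)" using l by metis
      qed
    next
      assume r: ?r
      show ?l
      proof (intro allI impI)
        fix t assume "t < k"
        then have "w - 1 - s - t \<in> D" "w - 1 - s - (w - 1 - s - t) = t"
          using assms(3) by (auto simp: D_def k_def)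
        then show "digit b v (w - 1 - s - t) = B ! t" using r by metis
      qed
    qed
    finally show ?thesis .
  qed
  moreover have "B ! (w - 1 - s - e) < b" if "e \<in> D" for e
  proof -
    have "w - 1 - s - e < length B" using that assms(3) by (auto simp: D_def k_def)
    then show ?thesis using assms(2) nth_mem by blast
  qed
  moreover have "D \<subseteq> {..<w}" by (auto simp: D_def)
  moreover have "card D = length B" using assms(3) by (simp add: D_def k_def)
  ultimately show ?thesis
    using card_digits_prescribed[of b D w "\<lambda>e. B ! (w - 1 - s - e)"] assms(1) by simp
qed

text \<open>An occurrence straddling the words \<open>v\<close> and \<open>v + 1\<close> prescribes the last digits of \<open>v\<close> and the
  first digits of \<open>v + 1\<close>; the former amounts to prescribing the last digits of \<open>v + 1\<close> as well.\<close>

lemma card_C_match_straddling: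
  assumes "b > 0" "set B \<subseteq> {..<b}" "length B \<le> w" "s < w" "w < s + length B"
  shows "card {v. v < b ^ w \<and> C_match b w B (v * w + s)} = b ^ (w - length B)"
proof -
  \<comment> \<open>\<open>h\<close> letters of the window fall into word \<open>v\<close> and the
    remaining \<open>k - h\<close> into the next word; \<open>D\<close> collects the positions they
    prescribe in the successor of \<open>v\<close>, the last \<open>h\<close> and the first
    \<open>k - h\<close>.\<close>
  define k h where "k = length B" and "h = w - s"
  define D where "D = {..<h} \<union> {w + h - k..<w}"
  have hk: "0 < h" "h < k" "h \<le> w" "k \<le> w" "s = w - h"
    using assms by (auto simp: k_def h_def)
  have B: "B ! t < b" if "t < k" for t
    using that assms(2) nth_mem unfolding k_def by blast
  \<comment> \<open>Some \<open>a\<close> has the first \<open>h\<close> letters of \<open>B\<close>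
    as its last \<open>h\<close> digits. The last \<open>h\<close> digits required of the successor
    of \<open>v\<close> are then those of \<open>Suc a\<close>.\<close>
  have "card {a. a < b ^ h \<and> (\<forall>e\<in>{..<h}. digit b a e = B ! (h - 1 - e))} = b ^ (h - card {..<h})"
    using B hk by (intro card_digits_prescribed) (auto simp: assms(1))
  then have "{a. a < b ^ h \<and> (\<forall>e\<in>{..<h}. digit b a e = B ! (h - 1 - e))} \<noteq> {}"
    by (metis card.empty card_lessThan diff_self_eq_0 power_0 zero_neq_one)
  then obtain a where a: "\<And>e. e < h \<Longrightarrow> digit b a e = B ! (h - 1 - e)"
    by auto
  define f where "f e = (if e < h then digit b (Suc a) e else B ! (w + h - 1 - e))" for e
  have "C_match b w B (v * w + s) \<longleftrightarrow> (\<forall>e\<in>D. digit b (Suc v mod b ^ w) e = f e)" for v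
  proof -
    have low: "C_digit b w (v * w + s + t) = digit b v (h - 1 - t)" if "t < h" for t
      using that hk C_digit_word[of "s + t" w b v] by (simp add: add.assoc)
    have high: "C_digit b w (v * w + s + t) = digit b (Suc v) (w + h - 1 - t)" if "h \<le> t" "t < k" for t
    proof -
      have "v * w + s + t = Suc v * w + (t - h)" "w - 1 - (t - h) = w + h - 1 - t"
        using that hk by auto
      then show ?thesis using C_digit_word[of "t - h" w b "Suc v"] that hk by simp
    qed
    have match_iff: "C_match b w B (v * w + s) \<longleftrightarrow>
        (\<forall>t<h. digit b v (h - 1 - t) = B ! t) \<and>
        (\<forall>t. h \<le> t \<and> t < k \<longrightarrow> digit b (Suc v) (w + h - 1 - t) = B ! t)"
      unfolding C_match_def k_def[symmetric]
      using low high hk by (smt (verit) leI order.strict_trans)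
    have low_iff: "(\<forall>t<h. digit b v (h - 1 - t) = B ! t) \<longleftrightarrow> (\<forall>e<h. digit b v e = digit b a e)"
      (is "?l \<longleftrightarrow> ?r")
    proof
      assume l: ?l
      show ?r
      proof (intro allI impI)
        fix e assume "e < h"
        then have "h - 1 - e < h" "h - 1 - (h - 1 - e) = e" by auto
        then show "digit b v e = digit b a e" using l a[OF \<open>e < h\<close>] by metis
      qed
    next
      assume r: ?r
      show ?l
      proof (intro allI impI)
        fix t assume "t < h"
        then have "h - 1 - t < h" "h - 1 - (h - 1 - t) = t" by auto
        then show "digit b v (h - 1 - t) = B ! t" using r a by metis
      qed
    qed
    have "(\<forall>e<h. digit b v e = digit b a e) \<longleftrightarrow> v mod b ^ h = a mod b ^ h"
      by (rule digits_eq_iff_mod_eq)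
    \<comment> \<open>Adding 1 is injective on residues modulo \<open>b ^ h\<close>, so carries are
      taken care of.\<close>
    also have "\<dots> \<longleftrightarrow> Suc v mod b ^ h = Suc a mod b ^ h"
      by (metis mod_Suc nat.inject nat.simps(3))
    also have "\<dots> \<longleftrightarrow> (\<forall>e<h. digit b (Suc v) e = digit b (Suc a) e)"
      by (rule digits_eq_iff_mod_eq[symmetric])
    finally have "(\<forall>e<h. digit b v e = digit b a e) \<longleftrightarrow> (\<forall>e<h. digit b (Suc v) e = digit b (Suc a) e)" .
    moreover have "(\<forall>t. h \<le> t \<and> t < k \<longrightarrow> digit b (Suc v) (w + h - 1 - t) = B ! t) \<longleftrightarrow>
        (\<forall>e\<in>{w + h - k..<w}. digit b (Suc v) e = B ! (w + h - 1 - e))" (is "?l \<longleftrightarrow> ?r")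
    proof
      assume l: ?l
      show ?r
      proof
        fix e assume "e \<in> {w + h - k..<w}"
        then have "h \<le> w + h - 1 - e" "w + h - 1 - e < k" "w + h - 1 - (w + h - 1 - e) = e"
          using hk by auto
        then show "digit b (Suc v) e = B ! (w + h - 1 - e)" using l by metis
      qed
    next
      assume r: ?r
      show ?l
      proof (intro allI impI)
        fix t assume "h \<le> t \<and> t < k"
        then have "w + h - 1 - t \<in> {w + h - k..<w}" "w + h - 1 - (w + h - 1 - t) = t"
          using hk by auto
        then show "digit b (Suc v) (w + h - 1 - t) = B ! t" using r by metis
      qed
    qed
    moreover have "(\<forall>e<h. digit b (Suc v) e = digit b (Suc a) e) \<and>
          (\<forall>e\<in>{w + h - k..<w}. digit b (Suc v) e = B ! (w + h - 1 - e))
        \<longleftrightarrow> (\<forall>e\<in>D. digit b (Suc v) e = f e)"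
    proof -
      have "f e = digit b (Suc a) e" if "e < h" for e using that by (simp add: f_def)
      moreover have "f e = B ! (w + h - 1 - e)" if "w + h - k \<le> e" for e
      proof -
        have "\<not> e < h" using that hk by linarith
        then show ?thesis by (simp add: f_def)
      qed
      ultimately show ?thesis by (auto simp: D_def ball_Un)
    qed
    \<comment> \<open>The reduction modulo \<open>b ^ w\<close> makes word 0 the successor of the
      last word, which is the cyclic reading.\<close>
    moreover have "(\<forall>e\<in>D. digit b (Suc v) e = f e) \<longleftrightarrow> (\<forall>e\<in>D. digit b (Suc v mod b ^ w) e = f e)"
      using hk by (intro ball_cong) (auto simp: D_def digit_mod)
    ultimately show ?thesis using match_iff low_iff by simp
  qed
  then have "card {v. v < b ^ w \<and> C_match b w B (v * w + s)}
      = card {v. v < b ^ w \<and> (\<forall>e\<in>D. digit b (Suc v mod b ^ w) e = f e)}"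
    by simp
  also have "\<dots> = card {u. u < b ^ w \<and> (\<forall>e\<in>D. digit b u e = f e)}"
    by (rule card_Suc_mod)
  also have "\<dots> = b ^ (w - card D)"
    using B hk by (intro card_digits_prescribed) (auto simp: D_def f_def assms(1) digit_less)
  \<comment> \<open>The two ranges are disjoint because \<open>k \<le> w\<close>; they have
    \<open>h\<close> and \<open>k - h\<close> elements.\<close>
  also have "card D = k"
    using hk unfolding D_def by (subst card_Un_disjoint) auto
  finally show ?thesis by (simp add: k_def)
qed

lemma card_C_match:
  assumes "b > 0" "set B \<subseteq> {..<b}" "length B \<le> w"
  shows "card {j. j < b ^ w * w \<and> C_match b w B j} = w * b ^ (w - length B)"
proof -
  \<comment> \<open>Occurrences are sorted by their offset \<open>s\<close> within a word; all
    \<open>w\<close> offsets contribute equally, whether or not the window straddles two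
    words.\<close>
  have "card {j. j < b ^ w * w \<and> C_match b w B j}
      = (\<Sum>s<w. card {v. v < b ^ w \<and> C_match b w B (v * w + s)})"
    by (rule card_less_mult)
  also have "\<dots> = (\<Sum>s<w. b ^ (w - length B))"
  proof (rule sum.cong)
    fix s assume "s \<in> {..<w}"
    then show "card {v. v < b ^ w \<and> C_match b w B (v * w + s)} = b ^ (w - length B)"
      using assms card_C_match_aligned[of b B s w] card_C_match_straddling[of b B w s]
      by (cases "s + length B \<le> w") auto
  qed simp
  finally show ?thesis by simp
qed

subsection \<open>Uniqueness of Cantor series expansions\<close>

context
  fixes q :: "nat \<Rightarrow> nat"
  assumes q: "basic_sequence q"
begin

lemma basic_ge_2: "n \<ge> 1 \<Longrightarrow> real (q n) \<ge> 2"
  using q by (auto simp: basic_sequence_def)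

lemma prod_basic_pos: "(\<Prod>j=1..n. real (q j)) > 0"
  using basic_ge_2 by (intro prod_pos) force

text \<open>The bound telescopes: a digit at most \<open>q m - 1\<close> contributes at most the
  difference of the reciprocals of two consecutive partial products.\<close>

lemma cantor_sum_le:
  assumes "\<And>n. n \<ge> 1 \<Longrightarrow> E n \<le> q n - 1" "n \<le> m"
  shows "(\<Sum>i=n..<m. real (E (Suc i)) / (\<Prod>j=1..Suc i. real (q j)))
    \<le> 1 / (\<Prod>j=1..n. real (q j)) - 1 / (\<Prod>j=1..m. real (q j))"
  using assms(2)
proof (induction m rule: dec_induct)
  case (step m)
  have "real (E (Suc m)) + 1 \<le> real (q (Suc m))"
    using assms(1)[of "Suc m"] basic_ge_2[of "Suc m"] by linarith
  then have "(real (E (Suc m)) + 1) / (\<Prod>j=1..Suc m. real (q j)) \<le> real (q (Suc m)) / (\<Prod>j=1..Suc m. real (q j))"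
    using prod_basic_pos[of "Suc m"] by (intro divide_right_mono) auto
  also have "\<dots> = 1 / (\<Prod>j=1..m. real (q j))"
    using basic_ge_2[of "Suc m"] by simp
  finally show ?case
    using step by (simp add: add_divide_distrib)
qed simp

lemma cantor_summable:
  assumes "\<And>n. n \<ge> 1 \<Longrightarrow> E n \<le> q n - 1"
  shows "summable (\<lambda>n. real (E (Suc n)) / (\<Prod>j=1..Suc n. real (q j)))"
proof (rule bounded_imp_summable)
  show "real (E (Suc n)) / (\<Prod>j=1..Suc n. real (q j)) \<ge> 0" for n
    using prod_basic_pos[of "Suc n"] by simp
  show "(\<Sum>i\<le>n. real (E (Suc i)) / (\<Prod>j=1..Suc i. real (q j))) \<le> 1" for n
  proof -
    have "(\<Sum>i\<le>n. real (E (Suc i)) / (\<Prod>j=1..Suc i. real (q j)))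
        \<le> 1 / (\<Prod>j=1..0. real (q j)) - 1 / (\<Prod>j=1..Suc n. real (q j))"
      using cantor_sum_le[of E 0 "Suc n", OF assms] by (simp only: atLeast0LessThan lessThan_Suc_atMost)
    also have "\<dots> \<le> 1"
      using prod_basic_pos[of "Suc n"] by simp
    finally show ?thesis .
  qed
qed

text \<open>The first \<open>n\<close> digits confine \<open>x\<close> to a half-open interval.
  Summation alone gives the closed interval; strictness on the right comes from a later digit that
  is not maximal.\<close>

lemma cantor_expansion_bounds:
  assumes "cantor_expansion q x E"
  shows "(\<Sum>i<n. real (E (Suc i)) / (\<Prod>j=1..Suc i. real (q j))) \<le> x"
    and "x < (\<Sum>i<n. real (E (Suc i)) / (\<Prod>j=1..Suc i. real (q j))) + 1 / (\<Prod>j=1..n. real (q j))"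
proof -
  define a P where "a i = real (E (Suc i)) / (\<Prod>j=1..Suc i. real (q j))"
    and "P n = (\<Prod>j=1..n. real (q j))" for i n
  have P: "P n > 0" for n using prod_basic_pos by (simp add: P_def)
  have sums: "a sums x" and E: "\<And>n. n \<ge> 1 \<Longrightarrow> E n \<le> q n - 1"
    and inf: "infinite {n. n \<ge> 1 \<and> E n \<noteq> q n - 1}"
    using assms by (auto simp: cantor_expansion_def a_def[abs_def])
  have a0: "a i \<ge> 0" for i using P[of "Suc i"] by (simp add: a_def P_def)
  have x: "x = suminf a" using sums sums_unique by blast
  show lower: "(\<Sum>i<n. a i) \<le> x" for n
    unfolding x using sums a0 by (intro sum_le_suminf) (auto simp: sums_iff)
  have le: "(\<Sum>i=n..<m. a i) \<le> 1 / P n - 1 / P m" if "n \<le> m" for n m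
    using cantor_sum_le[OF E that] by (simp add: a_def P_def)
  have upper: "x \<le> (\<Sum>i<n. a i) + 1 / P n" for n
  proof (rule LIMSEQ_le_const2)
    show "(\<lambda>m. \<Sum>i<m. a i) \<longlonglongrightarrow> x" using sums by (simp add: sums_def)
    have "(\<Sum>i<m. a i) \<le> (\<Sum>i<n. a i) + 1 / P n" if "n \<le> m" for m
    proof -
      have "(\<Sum>i<m. a i) = (\<Sum>i<n. a i) + (\<Sum>i=n..<m. a i)"
        using that by (metis atLeast0LessThan le0 sum.atLeastLessThan_concat)
      moreover have "1 / P m > 0" using P by simp
      ultimately show ?thesis using le[OF that] by linarith
    qed
    then show "\<exists>N. \<forall>m\<ge>N. (\<Sum>i<m. a i) \<le> (\<Sum>i<n. a i) + 1 / P n" by blast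
  qed
  \<comment> \<open>A nonmaximal digit at \<open>m > n\<close> falls short by at least
    \<open>1 / P m\<close> of what telescoping allows, and this gap survives in the bound for
    \<open>x\<close>.\<close>
  from inf obtain m where m: "m > n" "m \<ge> 1" "E m \<noteq> q m - 1"
    unfolding finite_nat_set_iff_bounded_le by (auto simp: not_le)
  then obtain m' where m': "m = Suc m'" "n \<le> m'" by (cases m) auto
  have "E m + 2 \<le> q m" using E[of m] m basic_ge_2[of m] by linarith
  then have "a m' \<le> (real (q m) - 2) / P m"
    unfolding a_def m'(1) P_def[symmetric] using P[of "Suc m'"]
    by (intro divide_right_mono) (auto simp: m'(1))
  also have "\<dots> = 1 / P m' - 2 / P m"
    using basic_ge_2[of m] m P[of m'] by (simp add: P_def m'(1) diff_divide_distrib)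
  finally have "a m' \<le> 1 / P m' - 2 / P m" .
  moreover have "(\<Sum>i<m. a i) = (\<Sum>i<n. a i) + (\<Sum>i=n..<m'. a i) + a m'"
    using m' by (simp add: sum.atLeastLessThan_concat[of 0 n m', symmetric] flip: atLeast0LessThan)
  moreover have "1 / P m > 0" "2 / P m = 1 / P m + 1 / P m" using P by simp_all
  ultimately show "x < (\<Sum>i<n. a i) + 1 / P n"
    using upper[of m] le[OF m'(2)] by linarith
qed

text \<open>At the first index where two expansions differ, they would place \<open>x\<close> in
  disjoint half-open intervals.\<close>

lemma cantor_expansion_unique:
  assumes "cantor_expansion q x E" "cantor_expansion q x F" "n \<ge> 1"
  shows "E n = F n"
  using assms(3)
proof (induction n rule: less_induct)
  case (less n)
  \<comment> \<open>Stated for arbitrary \<open>E\<close> and \<open>F\<close>, so that it excludes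
    both orders of the two digits.\<close>
  have no_less: False
    if EF: "cantor_expansion q x E" "cantor_expansion q x F"
      and eq: "\<And>m. m < n \<Longrightarrow> m \<ge> 1 \<Longrightarrow> E m = F m" and lt: "E n < F n" for E F
  proof -
    obtain n' where n': "n = Suc n'" using less.prems by (cases n) auto
    define P where "P = (\<Prod>j=1..n. real (q j))"
    have P: "P > 0" unfolding P_def by (rule prod_basic_pos)
    have same: "(\<Sum>i<n'. real (E (Suc i)) / (\<Prod>j=1..Suc i. real (q j)))
        = (\<Sum>i<n'. real (F (Suc i)) / (\<Prod>j=1..Suc i. real (q j)))"
    proof (intro sum.cong refl)
      fix i assume "i \<in> {..<n'}"
      then have "E (Suc i) = F (Suc i)" using eq n' by simp
      then show "real (E (Suc i)) / (\<Prod>j=1..Suc i. real (q j)) = real (F (Suc i)) / (\<Prod>j=1..Suc i. real (q j))"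
        by simp
    qed
    have "x < (\<Sum>i<n'. real (E (Suc i)) / (\<Prod>j=1..Suc i. real (q j))) + real (E n) / P + 1 / P"
      using cantor_expansion_bounds(2)[OF EF(1), of n] by (simp add: n' P_def)
    also have "\<dots> = (\<Sum>i<n'. real (F (Suc i)) / (\<Prod>j=1..Suc i. real (q j))) + (real (E n) + 1) / P"
      unfolding same by (simp only: add_divide_distrib add.assoc)
    also have "\<dots> \<le> (\<Sum>i<n'. real (F (Suc i)) / (\<Prod>j=1..Suc i. real (q j))) + real (F n) / P"
      using lt P by (intro add_left_mono divide_right_mono) auto
    also have "\<dots> \<le> x"
      using cantor_expansion_bounds(1)[OF EF(2), of n] by (simp add: n' P_def)
    finally show False by simp
  qed
  have eq: "\<And>m. m < n \<Longrightarrow> m \<ge> 1 \<Longrightarrow> E m = F m" using less.IH by blast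
  show ?case
    using no_less[OF assms(1,2) eq] no_less[OF assms(2,1) eq[symmetric]] by (cases "E n" "F n" rule: linorder_cases) auto
qed

lemma cantor_digits_eq:
  assumes "cantor_expansion q x E"
  shows "cantor_digits q x = E(0 := 0)"
  unfolding cantor_digits_def
proof (rule the_equality)
  have *: "{n. n \<ge> 1 \<and> (E(0 := 0)) n \<noteq> q n - 1} = {n. n \<ge> 1 \<and> E n \<noteq> q n - 1}" by auto
  show "(E(0 := 0)) 0 = 0 \<and> cantor_expansion q x (E(0 := 0))"
    using assms unfolding cantor_expansion_def * by simp
  fix F assume "F 0 = 0 \<and> cantor_expansion q x F"
  then show "F = E(0 := 0)"
    using cantor_expansion_unique[OF assms, of F] by (auto simp: fun_eq_iff)
qed

end

subsection \<open>Discrepancy of the concatenated sequence\<close>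

text \<open>The indicator of an occurrence minus its expected frequency, so that sums over whole
  periods vanish.\<close>

definition C_discrepancy :: "nat \<Rightarrow> nat \<Rightarrow> block \<Rightarrow> nat \<Rightarrow> real" where
  "C_discrepancy b w B j = of_bool (C_match b w B j) - 1 / real b ^ length B"

lemma sum_lessThan_add: "(\<Sum>j<m + n. f j) = (\<Sum>j<m. f j) + (\<Sum>j<n. f (m + j))"
  for f :: "nat \<Rightarrow> 'a :: comm_monoid_add"
  by (induction n) (simp_all add: add.assoc)

lemma sum_C_match:
  assumes "b > 0" "set B \<subseteq> {..<b}" "length B \<le> w"
  shows "(\<Sum>j<b ^ w * w. of_bool (C_match b w B j)) = real (b ^ w * w) / real b ^ length B"
proof -
  have "(\<Sum>j<b ^ w * w. of_bool (C_match b w B j) :: real) = real (card {j. j < b ^ w * w \<and> C_match b w B j})"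
    by (simp add: of_bool_def sum.If_cases Int_def)
  also have "\<dots> = real w * real b ^ (w - length B)"
    by (simp add: card_C_match[OF assms])
  also have "\<dots> = real (b ^ w * w) / real b ^ length B"
    using assms by (simp add: power_diff)
  finally show ?thesis .
qed

lemma sum_C_discrepancy_periods:
  assumes "b > 0" "set B \<subseteq> {..<b}" "length B \<le> w" "w > 0"
  shows "(\<Sum>j<m * (b ^ w * w). C_discrepancy b w B j) = 0"
proof (induction m)
  case (Suc m)
  have "C_discrepancy b w B (m * (b ^ w * w) + j) = C_discrepancy b w B j" for j
    unfolding C_discrepancy_def C_match_def add.assoc C_digit_add_period[OF assms(4)] ..
  moreover have "(\<Sum>j<b ^ w * w. C_discrepancy b w B j) = 0"
    unfolding C_discrepancy_def sum_subtractf sum_C_match[OF assms(1-3)] by simp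
  ultimately show ?case
    using sum_lessThan_add[of "C_discrepancy b w B" "m * (b ^ w * w)" "b ^ w * w"] Suc
    by (simp add: add.commute)
qed simp

text \<open>Whole periods cancel. In the remaining incomplete period the number of occurrences and
  its expected value both lie between 0 and the value for a full period, so their difference is no
  larger.\<close>

lemma abs_sum_C_discrepancy_le:
  assumes "b > 0" "set B \<subseteq> {..<b}" "length B \<le> w" "w > 0"
  shows "\<bar>\<Sum>j<T. C_discrepancy b w B j\<bar> \<le> real (b ^ w * w) / real b ^ length B"
proof -
  define M m r where "M = b ^ w * w" and "m = T div M" and "r = T mod M"
  have T: "T = m * M + r"
    unfolding m_def r_def by (rule div_mult_mod_eq[symmetric])
  have r: "r \<le> M"
    using assms by (simp add: r_def M_def less_imp_le)
  have per: "C_discrepancy b w B (m * M + j) = C_discrepancy b w B j" for j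
    unfolding M_def C_discrepancy_def C_match_def add.assoc C_digit_add_period[OF assms(4)] ..
  have "(\<Sum>j<T. C_discrepancy b w B j) = (\<Sum>j<r. C_discrepancy b w B j)"
    using sum_C_discrepancy_periods[OF assms, of m] by (simp add: T sum_lessThan_add per flip: M_def)
  also have "\<dots> = (\<Sum>j<r. of_bool (C_match b w B j)) - real r / real b ^ length B"
    by (simp add: C_discrepancy_def sum_subtractf)
  finally have eq: "(\<Sum>j<T. C_discrepancy b w B j) = (\<Sum>j<r. of_bool (C_match b w B j)) - real r / real b ^ length B" .
  have "(\<Sum>j<r. of_bool (C_match b w B j)) \<le> (\<Sum>j<M. of_bool (C_match b w B j) :: real)"
    using r by (intro sum_mono2) auto
  then have "(\<Sum>j<r. of_bool (C_match b w B j)) \<le> real M / real b ^ length B"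
    using sum_C_match[OF assms(1-3)] by (simp add: M_def)
  moreover have "real r / real b ^ length B \<le> real M / real b ^ length B"
    using r by (intro divide_right_mono) auto
  moreover have "0 \<le> real r / real b ^ length B" "0 \<le> (\<Sum>j<r. of_bool (C_match b w B j) :: real)"
    by (auto intro: sum_nonneg)
  ultimately show ?thesis unfolding eq M_def[symmetric] by linarith
qed

text \<open>The functions differ only on the last \<open>k\<close> positions before
  \<open>T'\<close>, by at most 2 each. It serves for windows that reach past the end of a
  stage.\<close>

lemma abs_sum_diff_le:
  fixes f g :: "nat \<Rightarrow> real"
  assumes "\<And>j. \<bar>f j\<bar> \<le> 1" "\<And>j. \<bar>g j\<bar> \<le> 1"
    and "\<And>j. j + k \<le> T' \<Longrightarrow> f j = g j" and "T \<le> T'"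
  shows "\<bar>(\<Sum>j<T. f j) - (\<Sum>j<T. g j)\<bar> \<le> 2 * real k"
proof -
  have "\<bar>(\<Sum>j<T. f j) - (\<Sum>j<T. g j)\<bar> \<le> (\<Sum>j<T. \<bar>f j - g j\<bar>)"
    unfolding sum_subtractf[symmetric] by (rule sum_abs)
  also have "\<dots> \<le> (\<Sum>j<T'. \<bar>f j - g j\<bar>)"
    using assms(4) by (intro sum_mono2) auto
  also have "\<dots> = (\<Sum>j\<in>{T' - k..<T'}. \<bar>f j - g j\<bar>)"
    using assms(3) by (intro sum.mono_neutral_right) auto
  also have "\<dots> \<le> (\<Sum>j\<in>{T' - k..<T'}. 2)"
  proof (rule sum_mono)
    show "\<bar>f j - g j\<bar> \<le> 2" for j using assms(1)[of j] assms(2)[of j] by linarith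
  qed
  also have "\<dots> \<le> 2 * real k" by simp
  finally show ?thesis .
qed

text \<open>Collects the data of the construction. The infinite concatenation is expressed through
  its prefixes of length \<open>L i\<close>, which determine all digits from index 1 on because
  \<open>L\<close> is unbounded.\<close>

locale concatenated_C =
  fixes X :: "nat \<Rightarrow> block" and b l L q E :: "nat \<Rightarrow> nat" and x :: real
  assumes X1: "X 1 = [0, 1]" and b1: "b 1 = 2" and l1: "l 1 = 0"
    and X: "\<And>i. i \<ge> 2 \<Longrightarrow> X i = C i (i^2)"
    and b: "\<And>i. i \<ge> 2 \<Longrightarrow> b i = i"
    and l: "\<And>i. i \<ge> 2 \<Longrightarrow> l i = i^(3*i)"
    and L: "\<And>i. L i = (\<Sum>j=1..i. l j * length (X j))"
    and q: "\<And>i n. i \<ge> 1 \<Longrightarrow> L (i - 1) < n \<Longrightarrow> n \<le> L i \<Longrightarrow> q n = b i"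
    and E: "\<And>i. map E [1..<Suc (L i)] = concat (map (\<lambda>j. copies (l j) (X j)) [1..<Suc i])"
    and x: "x = (\<Sum>n. real (E (Suc n)) / (\<Prod>j=1..Suc n. real (q j)))"
begin

section \<open>The stages of the concatenated sequence\<close>

definition M :: "nat \<Rightarrow> nat" where
  "M i = i ^ (i^2) * i^2"

lemma M_ge: "i \<ge> 1 \<Longrightarrow> i^2 \<le> M i"
  by (simp add: M_def)

lemma L_1: "L 1 = 0"
  using l1 by (simp add: L)

text \<open>From the second stage on, \<open>M\<close> is the length of the repeated block; at index
  1 the two differ.\<close>

lemma L_Suc: "i \<ge> 1 \<Longrightarrow> L (Suc i) = L i + l (Suc i) * M (Suc i)"
  unfolding L by (simp add: X length_C M_def)

lemma L_mono: "i \<le> j \<Longrightarrow> L i \<le> L j"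
  unfolding L by (intro sum_mono2) auto

text \<open>The factor 2 ensures that dropping \<open>k \<le> i\<close> positions leaves at least
  half of a stage.\<close>

lemma le_lM:
  assumes "i \<ge> 2"
  shows "2 * i \<le> l i * M i"
proof -
  have "2 * i \<le> i^2" using assms by (simp add: power2_eq_square)
  also have "\<dots> \<le> M i" using M_ge assms by simp
  also have "\<dots> \<le> l i * M i" using assms by (simp add: l)
  finally show ?thesis .
qed

lemma lM_pos: "i \<ge> 2 \<Longrightarrow> 0 < l i * M i"
  using le_lM[of i] by linarith

text \<open>A crude growth bound, enough to make the stages exhaust all positions. The
  \<open>Suc\<close> accommodates \<open>L 1 = 0\<close>.\<close>

lemma L_ge: "i \<le> Suc (L i)"
proof (induction i)
  case (Suc i)
  show ?case
  proof (cases "i = 0")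
    case False
    then show ?thesis using Suc L_Suc[of i] le_lM[of "Suc i"] by simp
  qed simp
qed simp

lemma stage_exists:
  assumes "n \<ge> 1"
  obtains i where "i \<ge> 1" "L i < n" "n \<le> L (Suc i)"
proof -
  define i where "i = (LEAST i. n \<le> L i)"
  have le: "n \<le> L i"
    unfolding i_def by (rule LeastI[of _ "Suc n"]) (use L_ge[of "Suc n"] in simp)
  have "L 0 = 0" by (simp add: L)
  \<comment> \<open>Both \<open>L 0\<close> and \<open>L 1\<close> vanish, so the first nonempty
    stage is the second one.\<close>
  then have "i \<noteq> 0" "i \<noteq> 1" using le assms L_1 by (metis le_zero_eq not_one_le_zero)+
  then obtain j where j: "i = Suc j" "j \<ge> 1" by (cases i) auto
  moreover have "L j < n"
    using not_less_Least[of j "\<lambda>i. n \<le> L i"] j unfolding i_def by auto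
  ultimately show ?thesis using le that by blast
qed

lemma q_stage:
  assumes "i \<ge> 1" "t < l (Suc i) * M (Suc i)"
  shows "q (Suc (L i) + t) = Suc i"
  using q[of "Suc i" "Suc (L i) + t"] assms L_Suc[OF assms(1)] by (simp add: b)

lemma E_stage:
  assumes "i \<ge> 1" "t < l (Suc i) * M (Suc i)"
  shows "E (Suc (L i) + t) = C_digit (Suc i) ((Suc i)^2) t"
proof -
  \<comment> \<open>Two consecutive prefixes differ exactly by one stage; cancelling the common part
    isolates its digits.\<close>
  have "map E [1..<Suc (L (Suc i))] = map E [1..<Suc (L i)] @ copies (l (Suc i)) (X (Suc i))"
    unfolding E using assms(1) by simp
  moreover have "[1..<Suc (L (Suc i))] = [1..<Suc (L i)] @ [Suc (L i)..<Suc (L i) + l (Suc i) * M (Suc i)]"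
    using upt_add_eq_append[of 1 "Suc (L i)" "l (Suc i) * M (Suc i)"] L_Suc[OF assms(1)] by simp
  ultimately have "map E [Suc (L i)..<Suc (L i) + l (Suc i) * M (Suc i)]
      = map (C_digit (Suc i) ((Suc i)^2)) [0..<l (Suc i) * M (Suc i)]"
    using assms(1) by (simp only: map_append append_same_eq same_append_eq)
      (simp add: X copies_C_eq M_def)
  from arg_cong[OF this, of "\<lambda>xs. xs ! t"] show ?thesis
    using assms(2) by (simp del: upt_Suc)
qed

lemma stage_index:
  assumes "n \<ge> 1"
  obtains i t where "i \<ge> 1" "t < l (Suc i) * M (Suc i)" "n = Suc (L i) + t"
proof -
  obtain i where i: "i \<ge> 1" "L i < n" "n \<le> L (Suc i)" using stage_exists[OF assms] .
  then have "n - Suc (L i) < l (Suc i) * M (Suc i)" "n = Suc (L i) + (n - Suc (L i))"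
    using L_Suc[OF i(1)] by auto
  then show ?thesis using that i(1) by blast
qed

section \<open>The digits \<open>E\<close> form the Cantor series expansion of
  \<open>x\<close>\<close>

lemma basic_sequence_q: "basic_sequence q"
  unfolding basic_sequence_def
proof (intro allI impI)
  fix n :: nat assume "n \<ge> 1"
  then obtain i t where it: "i \<ge> 1" "t < l (Suc i) * M (Suc i)" "n = Suc (L i) + t"
    by (rule stage_index)
  then show "q n \<ge> 2" using q_stage[OF it(1,2)] by simp
qed

lemma E_le:
  assumes "n \<ge> 1"
  shows "E n \<le> q n - 1"
proof -
  obtain i t where it: "i \<ge> 1" "t < l (Suc i) * M (Suc i)" "n = Suc (L i) + t"
    using stage_index[OF assms] .
  then show ?thesis
    using q_stage[OF it(1,2)] E_stage[OF it(1,2)] digit_less[of "Suc i"]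
    by (simp add: C_digit_def less_Suc_eq_le)
qed

lemma cantor_expansion_E: "cantor_expansion q x E"
proof -
  have "infinite {n. n \<ge> 1 \<and> E n \<noteq> q n - 1}"
    unfolding finite_nat_set_iff_bounded_le not_ex
  proof
    fix m
    \<comment> \<open>Each stage starts with the digit 0, as the first word of \<open>C\<close>
      consists of zeros, and 0 is not maximal. By \<open>L_ge\<close>, this choice of
      \<open>i\<close> puts the stage beyond \<open>m\<close>.\<close>
    define i where "i = Suc m"
    have "0 < l (Suc i) * M (Suc i)" by (intro lM_pos) (simp add: i_def)
    moreover have "i \<ge> 1" by (simp add: i_def)
    ultimately have "E (Suc (L i)) = 0" "q (Suc (L i)) = Suc i"
      using E_stage[of i 0] q_stage[of i 0] by (simp_all add: C_digit_def digit_def)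
    then have "Suc (L i) \<in> {n. n \<ge> 1 \<and> E n \<noteq> q n - 1}" by (simp add: i_def)
    moreover have "\<not> Suc (L i) \<le> m" using L_ge[of i] by (simp add: i_def)
    ultimately show "\<not> (\<forall>n\<in>{n. n \<ge> 1 \<and> E n \<noteq> q n - 1}. n \<le> m)" by blast
  qed
  moreover have "(\<lambda>n. real (E (Suc n)) / (\<Prod>j=1..Suc n. real (q j))) sums x"
    unfolding x using cantor_summable[OF basic_sequence_q E_le] by (rule summable_sums)
  ultimately show ?thesis
    using E_le by (auto simp: cantor_expansion_def)
qed

section \<open>Discrepancy sums over stages\<close>

definition discrepancy :: "block \<Rightarrow> nat \<Rightarrow> real" where
  "discrepancy B p = of_bool (map E [p..<p + length B] = B) - 1 / (\<Prod>m=p..<p + length B. real (q m))"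

lemma N_minus_Q_sum:
  assumes "length B \<ge> 1"
  shows "real (N q n B x) - Q_sum q (length B) n = (\<Sum>p<n. discrepancy B (Suc p))"
proof -
  \<comment> \<open>Windows starting at \<open>i \<ge> 1\<close> avoid index 0, the only place where
    \<open>cantor_digits q x\<close> and \<open>E\<close> can differ.\<close>
  have "map (cantor_digits q x) [i..<i + length B] = map E [i..<i + length B]" if "i \<ge> 1" for i
    using that by (simp add: cantor_digits_eq[OF basic_sequence_q cantor_expansion_E])
  then have "N q n B x = card {i \<in> {1..n}. map E [i..<i + length B] = B}"
    unfolding N_def by (intro arg_cong[of _ _ card] Collect_cong conj_cong refl) (simp only: atLeastAtMost_iff)
  also have "real \<dots> = (\<Sum>p=1..n. of_bool (map E [p..<p + length B] = B))"
    by (simp add: of_bool_def sum.If_cases Int_def)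
  finally have "real (N q n B x) - Q_sum q (length B) n = (\<Sum>p=1..n. discrepancy B p)"
    by (simp add: Q_sum_def discrepancy_def sum_subtractf)
  then show ?thesis
    by (simp add: sum.atLeast1_atMost_eq)
qed

lemma prod_q_ge_1:
  assumes "p \<ge> 1"
  shows "(\<Prod>m=p..<p + k. real (q m)) \<ge> 1"
proof (rule prod_ge_1)
  fix m assume "m \<in> {p..<p + k}"
  then have "real (q m) \<ge> 2" using basic_ge_2[OF basic_sequence_q, of m] assms by simp
  then show "1 \<le> real (q m)" by simp
qed

lemma abs_discrepancy_le:
  assumes "p \<ge> 1"
  shows "\<bar>discrepancy B p\<bar> \<le> 1"
proof -
  have "0 \<le> 1 / (\<Prod>m=p..<p + length B. real (q m))" "1 / (\<Prod>m=p..<p + length B. real (q m)) \<le> 1"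
    using prod_q_ge_1[OF assms, of "length B"] by simp_all
  then show ?thesis by (auto simp: discrepancy_def)
qed

lemma prod_q_stage:
  assumes "i \<ge> 1" "t + k \<le> l (Suc i) * M (Suc i)"
  shows "(\<Prod>m=Suc (L i) + t..<Suc (L i) + t + k. real (q m)) = real (Suc i) ^ k"
proof -
  have "real (q m) = real (Suc i)" if "m \<in> {Suc (L i) + t..<Suc (L i) + t + k}" for m
    using q_stage[OF assms(1), of "m - Suc (L i)"] that assms(2) by auto
  then show ?thesis by simp
qed

lemma discrepancy_stage:
  assumes "i \<ge> 1" "t + length B \<le> l (Suc i) * M (Suc i)"
  shows "discrepancy B (Suc (L i) + t) = C_discrepancy (Suc i) ((Suc i)^2) B t"
proof -
  have "map E [Suc (L i) + t..<Suc (L i) + t + length B] = B \<longleftrightarrow> C_match (Suc i) ((Suc i)^2) B t"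
    unfolding C_match_def list_eq_iff_nth_eq using assms E_stage[OF assms(1)]
    by (auto simp: add.assoc simp del: upt_Suc)
  then show ?thesis
    unfolding discrepancy_def C_discrepancy_def prod_q_stage[OF assms] by simp
qed

text \<open>Only windows starting among the last \<open>length B\<close> positions of a stage can
  meet the bases and digits of the next stage.\<close>

lemma sum_discrepancy_stage:
  assumes "i \<ge> 1" "set B \<subseteq> {..<Suc i}" "length B \<le> i" "T \<le> l (Suc i) * M (Suc i)"
  shows "\<bar>(\<Sum>t<T. discrepancy B (Suc (L i) + t)) - (\<Sum>t<T. C_discrepancy (Suc i) ((Suc i)^2) B t)\<bar>
    \<le> 2 * real (length B)"
proof (rule abs_sum_diff_le)
  show "\<bar>discrepancy B (Suc (L i) + t)\<bar> \<le> 1" for t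
    by (rule abs_discrepancy_le) simp
  have "0 \<le> 1 / real (Suc i) ^ length B" "1 / real (Suc i) ^ length B \<le> 1"
    using one_le_power[of "real (Suc i)" "length B"] by simp_all
  then show "\<bar>C_discrepancy (Suc i) ((Suc i)^2) B t\<bar> \<le> 1" for t
    by (auto simp: C_discrepancy_def)
qed (use assms discrepancy_stage in auto)

text \<open>A full stage consists of whole periods, so only its boundary contributes. Stages up to
  \<open>i\<^sub>0\<close>, where \<open>B\<close> may be too long or have digits too large for the
  base, go into a constant.\<close>

lemma abs_sum_discrepancy_L_le:
  assumes "i\<^sub>0 \<ge> 1" "set B \<subseteq> {..<Suc i\<^sub>0}" "length B \<le> i\<^sub>0" "i\<^sub>0 \<le> i"
  shows "\<bar>\<Sum>p<L i. discrepancy B (Suc p)\<bar>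
    \<le> \<bar>\<Sum>p<L i\<^sub>0. discrepancy B (Suc p)\<bar> + 2 * real (length B) * real i"
  using assms(4)
proof (induction i rule: dec_induct)
  case (step i)
  have B: "set B \<subseteq> {..<Suc i}" "length B \<le> i" "i \<ge> 1" using assms step.hyps by auto
  have le: "length B \<le> (Suc i)^2" using B(2) by (simp add: power2_eq_square)
  have "(\<Sum>t<l (Suc i) * M (Suc i). C_discrepancy (Suc i) ((Suc i)^2) B t) = 0"
    unfolding M_def using B le by (intro sum_C_discrepancy_periods) auto
  then have "\<bar>\<Sum>t<l (Suc i) * M (Suc i). discrepancy B (Suc (L i) + t)\<bar> \<le> 2 * real (length B)"
    using sum_discrepancy_stage[OF B(3,1,2) order_refl] by simp
  moreover have "(\<Sum>p<L (Suc i). discrepancy B (Suc p)) = (\<Sum>p<L i. discrepancy B (Suc p))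
      + (\<Sum>t<l (Suc i) * M (Suc i). discrepancy B (Suc (L i) + t))"
    by (simp add: L_Suc[OF B(3)] sum_lessThan_add)
  moreover have "2 * real (length B) * real (Suc i) = 2 * real (length B) * real i + 2 * real (length B)"
    by (simp add: algebra_simps)
  ultimately show ?case using step.IH by linarith
qed simp

text \<open>The last term accounts for the incomplete copy at the end; the boundary of the current
  stage turns the factor \<open>i\<close> into \<open>Suc i\<close>.\<close>

lemma abs_sum_discrepancy_le:
  assumes "i\<^sub>0 \<ge> 1" "set B \<subseteq> {..<Suc i\<^sub>0}" "length B \<le> i\<^sub>0" "i\<^sub>0 \<le> i"
    and "L i < n" "n \<le> L (Suc i)"
  shows "\<bar>\<Sum>p<n. discrepancy B (Suc p)\<bar>
    \<le> \<bar>\<Sum>p<L i\<^sub>0. discrepancy B (Suc p)\<bar> + 2 * real (length B) * real (Suc i)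
      + real (M (Suc i)) / real (Suc i) ^ length B"
proof -
  have B: "set B \<subseteq> {..<Suc i}" "length B \<le> i" "i \<ge> 1" using assms by auto
  have le: "length B \<le> (Suc i)^2" using B(2) by (simp add: power2_eq_square)
  define T where "T = n - L i"
  have T: "n = L i + T" "T \<le> l (Suc i) * M (Suc i)"
    using assms(5,6) L_Suc[OF B(3)] by (auto simp: T_def)
  have "\<bar>\<Sum>t<T. C_discrepancy (Suc i) ((Suc i)^2) B t\<bar> \<le> real (M (Suc i)) / real (Suc i) ^ length B"
    unfolding M_def using B le by (intro abs_sum_C_discrepancy_le) auto
  moreover note sum_discrepancy_stage[OF B(3,1,2) T(2)]
  moreover note abs_sum_discrepancy_L_le[OF assms(1-4)]
  moreover have "(\<Sum>p<n. discrepancy B (Suc p)) = (\<Sum>p<L i. discrepancy B (Suc p))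
      + (\<Sum>t<T. discrepancy B (Suc (L i) + t))"
    by (simp add: T sum_lessThan_add)
  moreover have "2 * real (length B) * real (Suc i) = 2 * real (length B) * real i + 2 * real (length B)"
    by (simp add: algebra_simps)
  ultimately show ?thesis by linarith
qed

section \<open>Growth of \<open>Q_sum\<close> and the limit\<close>

lemma Q_sum_ge:
  assumes "i \<ge> 2" "L i \<le> n"
  shows "(real (l i * M i) - real k) / real i ^ k \<le> Q_sum q k n"
proof -
  obtain j where j: "i = Suc j" "j \<ge> 1" using assms(1) by (cases i) auto
  \<comment> \<open>Only windows that stay inside stage \<open>i\<close> are kept, each of weight
    \<open>1 / i ^ k\<close>. If \<open>k\<close> exceeds the length of the stage, \<open>T\<close>
    is 0 and the claimed bound is negative.\<close>
  define T where "T = l i * M i - k"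
  have nonneg: "0 \<le> 1 / (\<Prod>m=Suc p..<Suc p + k. real (q m))" for p
    using prod_q_ge_1[of "Suc p" k] by (intro divide_nonneg_nonneg) linarith+
  have "real (l i * M i) - real k \<le> real T"
    unfolding T_def by linarith
  then have "(real (l i * M i) - real k) / real i ^ k \<le> real T / real i ^ k"
    by (intro divide_right_mono) auto
  also have "\<dots> = (\<Sum>t<T. 1 / real i ^ k)" by simp
  also have "\<dots> = (\<Sum>t<T. 1 / (\<Prod>m=Suc (L j + t)..<Suc (L j + t) + k. real (q m)))"
    using prod_q_stage[OF j(2), of _ k] unfolding j(1) T_def
    by (intro sum.cong) (auto simp: j(1))
  also have "\<dots> \<le> (\<Sum>p<L j. 1 / (\<Prod>m=Suc p..<Suc p + k. real (q m)))
      + (\<Sum>t<T. 1 / (\<Prod>m=Suc (L j + t)..<Suc (L j + t) + k. real (q m)))"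
    by (simp only: le_add_same_cancel2) (intro sum_nonneg nonneg)
  also have "\<dots> = (\<Sum>p<L j + T. 1 / (\<Prod>m=Suc p..<Suc p + k. real (q m)))"
    by (simp only: sum_lessThan_add)
  also have "\<dots> \<le> (\<Sum>p<n. 1 / (\<Prod>m=Suc p..<Suc p + k. real (q m)))"
    using assms(2) L_Suc[OF j(2)] by (intro sum_mono2 nonneg) (auto simp: T_def j(1))
  also have "\<dots> = Q_sum q k n"
    by (simp add: Q_sum_def sum.atLeast1_atMost_eq)
  finally show ?thesis .
qed

lemma real_M:
  assumes "i \<ge> 1"
  shows "real (M i) = exp ((real i ^ 2 + 2) * ln (real i))"
proof -
  have "real (M i) = real i ^ (i^2 + 2)"
    by (simp add: M_def power_add power2_eq_square)
  also have "\<dots> = exp (real (i^2 + 2) * ln (real i))"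
    using assms by (simp only: exp_of_nat_mult) simp
  finally show ?thesis by simp
qed

text \<open>After taking logarithms, going from \<open>i\<close> to \<open>Suc i\<close> in
  \<open>M\<close> costs about \<open>2 * i * ln i\<close>, while the copies gain
  \<open>3 * i * ln i\<close>.\<close>

lemma M_ratio_tendsto: "(\<lambda>i. real (M (Suc i)) / real (l i * M i)) \<longlonglongrightarrow> 0"
proof (rule Lim_transform_eventually)
  show "(\<lambda>i. exp ((real (Suc i) ^ 2 + 2) * ln (real (Suc i)) - (real i ^ 2 + 3 * real i + 2) * ln (real i)))
      \<longlonglongrightarrow> 0"
    by real_asymp
  show "\<forall>\<^sub>F i in sequentially. exp ((real (Suc i) ^ 2 + 2) * ln (real (Suc i)) - (real i ^ 2 + 3 * real i + 2) * ln (real i))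
      = real (M (Suc i)) / real (l i * M i)"
    using eventually_ge_at_top[of 2]
  proof eventually_elim
    case (elim i)
    have "real (l i) = exp (real (3 * i) * ln (real i))"
      using elim by (simp only: exp_of_nat_mult) (simp add: l)
    then have "real (l i * M i) = exp ((real i ^ 2 + 3 * real i + 2) * ln (real i))"
      using elim by (simp add: real_M ring_distribs flip: exp_add)
    then show ?case by (simp add: real_M exp_diff)
  qed
qed

lemma N_over_Q_sum_tendsto:
  assumes "length B = k" "k \<ge> 1"
  shows "(\<lambda>n. real (N q n B x) / Q_sum q k n) \<longlonglongrightarrow> 1"
proof -
  \<comment> \<open>From here on every later stage has a base exceeding all digits of
    \<open>B\<close>, and \<open>k\<close> is at most the stage index.\<close>
  define i\<^sub>0 where "i\<^sub>0 = Max (insert 2 (insert k (set B)))"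
  have i0: "i\<^sub>0 \<ge> 2" "k \<le> i\<^sub>0" "set B \<subseteq> {..<Suc i\<^sub>0}"
    by (auto simp: i\<^sub>0_def less_Suc_eq_le intro!: Max_ge simp del: Max_insert)
  define K where "K = \<bar>\<Sum>p<L i\<^sub>0. discrepancy B (Suc p)\<bar>"
  \<comment> \<open>A bound on the relative error that depends on the stage only: stage boundaries
    and early stages first, then the incomplete copy. The factors 2 come from bounding
    \<open>Q_sum\<close> below by half a stage.\<close>
  define R where "R i = 2 * (K + 2 * real k * real (Suc i)) / real i ^ 2
      + 2 * (real (M (Suc i)) / real (l i * M i))" for i
  have "(\<lambda>i. 2 * (K + 2 * real k * real (Suc i)) / real i ^ 2) \<longlonglongrightarrow> 0"
    by real_asymp
  then have R: "R \<longlonglongrightarrow> 0 + 2 * 0"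
    unfolding R_def[abs_def] by (intro tendsto_intros M_ratio_tendsto)
  have bound: "\<bar>real (N q n B x) / Q_sum q k n - 1\<bar> \<le> R i"
    if i: "i \<ge> i\<^sub>0" "L i < n" "n \<le> L (Suc i)" for i n
  proof -
    define A where "A = K + 2 * real k * real (Suc i)"
    have i2: "i \<ge> 2" "k \<le> i" using i i0 by auto
    have pos: "real (l i * M i) > 0" using lM_pos[OF i2(1)] by (simp only: of_nat_0_less_iff)
    have "real (2 * i) \<le> real (l i * M i)" using le_lM[OF i2(1)] by (rule of_nat_mono)
    then have "real (l i * M i) / 2 \<le> real (l i * M i) - real k" using i2 by linarith
    then have "real (l i * M i) / 2 / real i ^ k \<le> (real (l i * M i) - real k) / real i ^ k"
      by (intro divide_right_mono) auto
    also have "\<dots> \<le> Q_sum q k n" using i i2 by (intro Q_sum_ge) auto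
    finally have Q: "real (l i * M i) / 2 / real i ^ k \<le> Q_sum q k n" .
    moreover have Qpos: "real (l i * M i) / 2 / real i ^ k > 0" using pos i2 by simp
    ultimately have "Q_sum q k n > 0" by linarith
    then have "real (N q n B x) / Q_sum q k n - 1 = (real (N q n B x) - Q_sum q k n) / Q_sum q k n"
      by (simp add: field_simps)
    also have "\<bar>\<dots>\<bar> = \<bar>\<Sum>p<n. discrepancy B (Suc p)\<bar> / Q_sum q k n"
      using N_minus_Q_sum[of B n] assms \<open>Q_sum q k n > 0\<close> by simp
    also have "\<dots> \<le> (A + real (M (Suc i)) / real (Suc i) ^ k) / (real (l i * M i) / 2 / real i ^ k)"
      using abs_sum_discrepancy_le[of i\<^sub>0 B i n] i i0 assms(1) Q Qpos
      by (intro frac_le) (auto simp: A_def K_def)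
    also have "\<dots> = 2 * A * (real i ^ k / real (l i)) / real (M i)
        + 2 * (real (M (Suc i)) / real (l i * M i)) * (real i ^ k / real (Suc i) ^ k)"
      by (simp add: distrib_left add_divide_distrib mult_ac)
    \<comment> \<open>This uses \<open>i ^ k \<le> l i\<close>, which holds because
      \<open>k \<le> i\<close>, together with \<open>i ^ 2 \<le> M i\<close>; the result no longer
      involves \<open>k\<close> as an exponent.\<close>
    also have "\<dots> \<le> 2 * A * 1 / real i ^ 2 + 2 * (real (M (Suc i)) / real (l i * M i)) * 1"
    proof (intro add_mono mult_left_mono frac_le)
      have "real i ^ k \<le> real (l i)" using i2 by (simp add: l power_increasing)
      moreover have "real (l i) > 0" using i2 by (simp add: l)
      ultimately show "real i ^ k / real (l i) \<le> 1" by simp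
      show "real i ^ k / real (Suc i) ^ k \<le> 1"
        by (simp add: power_mono divide_le_eq_1)
      have "real (i^2) \<le> real (M i)" using M_ge i2 by (intro of_nat_mono) simp
      then show "real i ^ 2 \<le> real (M i)" by simp
    qed (use i2 in \<open>auto simp: A_def K_def\<close>)
    finally show ?thesis by (simp add: R_def A_def)
  qed
  show ?thesis
  proof (rule LIMSEQ_I)
    fix r :: real assume "r > 0"
    then have "\<forall>\<^sub>F i in sequentially. R i < r"
      using R by (intro order_tendstoD) auto
    then obtain I where I: "\<And>i. i \<ge> I \<Longrightarrow> R i < r"
      unfolding eventually_sequentially by blast
    \<comment> \<open>Positions beyond this threshold lie in stages late enough both for
      \<open>bound\<close> and for \<open>R i < r\<close>.\<close>
    have "norm (real (N q n B x) / Q_sum q k n - 1) < r" if n: "n \<ge> Suc (L (max I i\<^sub>0))" for n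
    proof -
      have "n \<ge> 1" using n by simp
      then obtain i where i: "i \<ge> 1" "L i < n" "n \<le> L (Suc i)" by (rule stage_exists)
      have "max I i\<^sub>0 \<le> i"
      proof (rule ccontr)
        assume "\<not> max I i\<^sub>0 \<le> i"
        then have "L (Suc i) \<le> L (max I i\<^sub>0)" by (intro L_mono) linarith
        then show False using n i by simp
      qed
      then show ?thesis using bound[of i n] I[of i] i by simp
    qed
    then show "\<exists>no. \<forall>n\<ge>no. norm (real (N q n B x) / Q_sum q k n - 1) < r" by blast
  qed
qed

lemma Q_normal: "Q_normal q x"
  unfolding Q_normal_def Q_normal_of_order_def
  \<comment> \<open>For the empty prefix of digits, the bounds on an expansion say
    \<open>0 \<le> x\<close> and \<open>x < 1\<close>.\<close>
  using basic_sequence_q N_over_Q_sum_tendsto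
    cantor_expansion_bounds[OF basic_sequence_q cantor_expansion_E, of 0] by auto

end

theorem theorem4p3:
  fixes X :: "nat \<Rightarrow> block" and b l L q E :: "nat \<Rightarrow> nat" and x :: real
  assumes "X 1 = [0, 1]" and "b 1 = 2" and "l 1 = 0"
    and "\<And>i. i \<ge> 2 \<Longrightarrow> X i = C i (i^2)"
    and "\<And>i. i \<ge> 2 \<Longrightarrow> b i = i"
    and "\<And>i. i \<ge> 2 \<Longrightarrow> l i = i^(3*i)"
    and "\<And>i. L i = (\<Sum>j=1..i. l j * length (X j))"
    and "\<And>i n. i \<ge> 1 \<Longrightarrow> L (i - 1) < n \<Longrightarrow> n \<le> L i \<Longrightarrow> q n = b i"
    and "\<And>i. map E [1..<Suc (L i)] = concat (map (\<lambda>j. copies (l j) (X j)) [1..<Suc i])"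
    and "x = (\<Sum>n. real (E (Suc n)) / (\<Prod>j=1..Suc n. real (q j)))"
  shows "Q_normal q x"
proof -
  interpret concatenated_C X b l L q E x
    by (unfold_locales; fact assms)
  show ?thesis by (rule Q_normal)
qed

end
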